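(* Let $(X,M,\ast)$ and $(Y,M',\ast)$ be compact fuzzy metric spaces, where $\ast$ is the \L ukasiewicz t-norm, and let $f\colon X\to Y$ be a nonexpanding map. Then the induced map $P(f)\colon (P(X),\hat M,\ast)\to (P(Y),\hat M',\ast)$ is also nonexpanding.
   Context: The \L ukasiewicz t-norm is $x\ast y=\max\{x+y-1,0\}$ for $x,y\in[0,1]$. A fuzzy metric (in the sense of George and Veeramani) with respect to $\ast$ on a set $Z$ is a function $N\colon Z\times Z\times(0,\infty)\to[0,1]$ such that for all $x,y,z\in Z$ and $s,t>0$: (i) $N(x,y,t)>0$; (ii) $N(x,y,t)=1$ if and only if $x=y$; (iii) $N(x,y,t)=N(y,x,t)$; (iv) $N(x,y,t)\ast N(y,z,s)\le N(x,z,t+s)$; (v) $N(x,y,-)\colon(0,\infty)\to(0,1]$ is continuous. Then $(Z,N,\ast)$ is called a fuzzy metric space. The open balls $\{y\in Z\mid N(x,y,t)>1-r\}$, $x\in Z$, $r\in(0,1)$, $t>0$, form a base of a (metrizable) topology $\tau_N$ on $Z$; compactness and Borel sets refer to this topology. A map $f\colon Z\to Z'$ between fuzzy metric spaces $(Z,N,\ast)$ and $(Z',N',\ast)$ is nonexpanding if $N'(f(x),f(y),t)\ge N(x,y,t)$ for all $x,y\in Z$ and $t>0$ (such a map is continuous). For a compact fuzzy metric space $(X,M,\ast)$, $P(X)$ is the set of Borel probability measures on $X$; $B(x,r,t)=\{y\in X\mid M(x,y,t)>1-r\}$; for $A\subset X$, $A^{r,t}=\bigcup\{B(x,r,t)\mid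 x\in A\}$; and the fuzzy Prokhorov metric $\hat M\colon P(X)\times P(X)\times(0,\infty)\to[0,1]$ is $$\hat M(\mu,\nu,t)=1-\inf\{r\in(0,1)\mid \mu(A)\le\nu(A^{r,t})+r \text{ and } \nu(A)\le\mu(A^{r,t})+r \text{ for every Borel } A\subset X\};$$ it is well defined and is a fuzzy metric on $P(X)$ with respect to $\ast$. $\hat M'$ is defined in the same way from $(Y,M',\ast)$. For a continuous map $f\colon X\to Y$, $P(f)\colon P(X)\to P(Y)$ is the pushforward: $P(f)(\mu)(A)=\mu(f^{-1}(A))$ for every Borel $A\subset Y$. *)

theory Defs
  imports "HOL-Probability.Probability"
begin

definition luk :: "real \<Rightarrow> real \<Rightarrow> real" where
  "luk x y = max (x + y - 1) 0"

(* Only the values of N on Z \<times> Z \<times> (0,\<infinity>) are constrained or ever used. *)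
locale fuzzy_metric_space =
  fixes Z :: "'a set" and N :: "'a \<Rightarrow> 'a \<Rightarrow> real \<Rightarrow> real"
  assumes range: "\<lbrakk>x \<in> Z; y \<in> Z; 0 < t\<rbrakk> \<Longrightarrow> N x y t \<in> {0..1}"
    and pos: "\<lbrakk>x \<in> Z; y \<in> Z; 0 < t\<rbrakk> \<Longrightarrow> 0 < N x y t"
    and eq_1_iff: "\<lbrakk>x \<in> Z; y \<in> Z; 0 < t\<rbrakk> \<Longrightarrow> N x y t = 1 \<longleftrightarrow> x = y"
    and sym: "\<lbrakk>x \<in> Z; y \<in> Z; 0 < t\<rbrakk> \<Longrightarrow> N x y t = N y x t"
    and triangle: "\<lbrakk>x \<in> Z; y \<in> Z; z \<in> Z; 0 < t; 0 < s\<rbrakk> \<Longrightarrow> luk (N x y t) (N y z s) \<le> N x z (t + s)"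
    and cont: "\<lbrakk>x \<in> Z; y \<in> Z\<rbrakk> \<Longrightarrow> continuous_on {0<..} (N x y)"

definition fuzzy_ball :: "'a set \<Rightarrow> ('a \<Rightarrow> 'a \<Rightarrow> real \<Rightarrow> real) \<Rightarrow> 'a \<Rightarrow> real \<Rightarrow> real \<Rightarrow> 'a set" where
  "fuzzy_ball Z N x r t = {y \<in> Z. N x y t > 1 - r}"

(* The balls are taken as a subbase; lemma openin_fuzzy_topology_base below shows that
   for a fuzzy metric they are in fact a base. *)
definition fuzzy_topology :: "'a set \<Rightarrow> ('a \<Rightarrow> 'a \<Rightarrow> real \<Rightarrow> real) \<Rightarrow> 'a topology" where
  "fuzzy_topology Z N =
     topology_generated_by {fuzzy_ball Z N x r t | x r t. x \<in> Z \<and> 0 < r \<and> r < 1 \<and> 0 < t}"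

definition fuzzy_borel :: "'a set \<Rightarrow> ('a \<Rightarrow> 'a \<Rightarrow> real \<Rightarrow> real) \<Rightarrow> 'a measure" where
  "fuzzy_borel Z N = sigma Z {U. openin (fuzzy_topology Z N) U}"

definition prob_measures :: "'a set \<Rightarrow> ('a \<Rightarrow> 'a \<Rightarrow> real \<Rightarrow> real) \<Rightarrow> 'a measure set" where
  "prob_measures Z N = {\<mu>. prob_space \<mu> \<and> sets \<mu> = sets (fuzzy_borel Z N)}"

definition fuzzy_enlarge :: "'a set \<Rightarrow> ('a \<Rightarrow> 'a \<Rightarrow> real \<Rightarrow> real) \<Rightarrow> 'a set \<Rightarrow> real \<Rightarrow> real \<Rightarrow> 'a set" where
  "fuzzy_enlarge Z N A r t = (\<Union>x\<in>A. fuzzy_ball Z N x r t)"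

definition fuzzy_prokhorov ::
  "'a set \<Rightarrow> ('a \<Rightarrow> 'a \<Rightarrow> real \<Rightarrow> real) \<Rightarrow> 'a measure \<Rightarrow> 'a measure \<Rightarrow> real \<Rightarrow> real" where
  "fuzzy_prokhorov Z N \<mu> \<nu> t =
     1 - Inf {r. 0 < r \<and> r < 1 \<and> (\<forall>A \<in> sets (fuzzy_borel Z N).
            measure \<mu> A \<le> measure \<nu> (fuzzy_enlarge Z N A r t) + r \<and>
            measure \<nu> A \<le> measure \<mu> (fuzzy_enlarge Z N A r t) + r)}"

definition nonexpanding ::
  "'a set \<Rightarrow> ('a \<Rightarrow> 'a \<Rightarrow> real \<Rightarrow> real) \<Rightarrow> 'b set \<Rightarrow> ('b \<Rightarrow> 'b \<Rightarrow> real \<Rightarrow> real) \<Rightarrow> ('a \<Rightarrow> 'b) \<Rightarrow> bool" where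
  "nonexpanding Z N Z' N' f \<longleftrightarrow>
     f \<in> Z \<rightarrow> Z' \<and> (\<forall>x\<in>Z. \<forall>y\<in>Z. \<forall>t>0. N' (f x) (f y) t \<ge> N x y t)"

(* The library's distr is the image measure A \<mapsto> \<mu> (f -` A \<inter> space \<mu>) for measurable f. *)
definition push :: "'b set \<Rightarrow> ('b \<Rightarrow> 'b \<Rightarrow> real \<Rightarrow> real) \<Rightarrow> ('a \<Rightarrow> 'b) \<Rightarrow> 'a measure \<Rightarrow> 'b measure" where
  "push Y M' f \<mu> = distr \<mu> (fuzzy_borel Y M') f"

context fuzzy_metric_space
begin

lemma mono_time:
  assumes "x \<in> Z" "y \<in> Z" "0 < s" "s \<le> t"
  shows "N x y s \<le> N x y t"
proof (cases "s = t")
  case False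
  then have *: "0 < t - s" using assms by simp
  have "N y y (t - s) = 1" using eq_1_iff[OF assms(2) assms(2) *] by simp
  then show ?thesis
    using triangle[OF assms(1,2,2,3) *] by (simp add: luk_def)
qed simp

lemma ball_refine:
  assumes "x \<in> Z" "r < 1" "0 < t" "y \<in> fuzzy_ball Z N x r t"
  obtains r' t' where "0 < r'" "r' < 1" "0 < t'" "fuzzy_ball Z N y r' t' \<subseteq> fuzzy_ball Z N x r t"
proof -
  have y: "y \<in> Z" "N x y t > 1 - r" using assms(4) by (auto simp: fuzzy_ball_def)
  have "isCont (N x y) t"
    using cont[OF assms(1) y(1)] assms(3) by (simp add: continuous_on_eq_continuous_at)
  then have "(N x y \<longlongrightarrow> N x y t) (at_left t)"
    by (auto simp: isCont_def intro: filterlim_at_split[THEN iffD1, THEN conjunct1])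
  then have "\<forall>\<^sub>F s in at_left t. N x y s > 1 - r"
    using y(2) by (rule order_tendstoD)
  moreover have "\<forall>\<^sub>F s in at_left t. s \<in> {0<..<t}"
    using assms(3) by (rule eventually_at_left_real)
  ultimately have "\<forall>\<^sub>F s in at_left t. N x y s > 1 - r \<and> s \<in> {0<..<t}"
    by (rule eventually_conj)
  then obtain s where s: "N x y s > 1 - r" "0 < s" "s < t"
    using eventually_happens[of _ "at_left t"] trivial_limit_at_left_real by fastforce
  define r' where "r' = (N x y s - (1 - r)) / 2"
  have le1: "N x y s \<le> 1" using range[OF assms(1) y(1) s(2)] by simp
  show thesis
  proof
    show "0 < r'" "r' < 1" "0 < t - s" using s le1 assms(2) by (auto simp: r'_def)
    show "fuzzy_ball Z N y r' (t - s) \<subseteq> fuzzy_ball Z N x r t"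
    proof
      fix z assume "z \<in> fuzzy_ball Z N y r' (t - s)"
      then have z: "z \<in> Z" "N y z (t - s) > 1 - r'" by (auto simp: fuzzy_ball_def)
      have "luk (N x y s) (N y z (t - s)) \<le> N x z t"
        using triangle[OF assms(1) y(1) z(1) s(2), of "t - s"] s by simp
      then have "N x y s + N y z (t - s) - 1 \<le> N x z t" by (simp add: luk_def)
      then have "N x z t > 1 - r" using z(2) s(1) unfolding r'_def by (simp add: field_simps)
      then show "z \<in> fuzzy_ball Z N x r t" using z(1) by (simp add: fuzzy_ball_def)
    qed
  qed
qed

lemma center_in_ball: "\<lbrakk>x \<in> Z; 0 < r; 0 < t\<rbrakk> \<Longrightarrow> x \<in> fuzzy_ball Z N x r t"
  using eq_1_iff[of x x t] by (simp add: fuzzy_ball_def)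

lemma ball_mono:
  "\<lbrakk>x \<in> Z; r \<le> r'; 0 < t; t \<le> t'\<rbrakk> \<Longrightarrow> fuzzy_ball Z N x r t \<subseteq> fuzzy_ball Z N x r' t'"
  using mono_time[of x _ t t'] by (force simp: fuzzy_ball_def)

lemma openin_fuzzy_topology_base:
  "openin (fuzzy_topology Z N) U \<longleftrightarrow>
     U \<subseteq> Z \<and> (\<forall>x\<in>U. \<exists>r t. 0 < r \<and> r < 1 \<and> 0 < t \<and> fuzzy_ball Z N x r t \<subseteq> U)"
proof
  assume "openin (fuzzy_topology Z N) U"
  then have "generate_topology_on {fuzzy_ball Z N x r t | x r t. x \<in> Z \<and> 0 < r \<and> r < 1 \<and> 0 < t} U"
    by (simp add: fuzzy_topology_def openin_topology_generated_by_iff)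
  then show "U \<subseteq> Z \<and> (\<forall>x\<in>U. \<exists>r t. 0 < r \<and> r < 1 \<and> 0 < t \<and> fuzzy_ball Z N x r t \<subseteq> U)"
  proof induction
    case Empty
    then show ?case by simp
  next
    case (Int a b)
    have "\<exists>r t. 0 < r \<and> r < 1 \<and> 0 < t \<and> fuzzy_ball Z N x r t \<subseteq> a \<inter> b" if x: "x \<in> a \<inter> b" for x
    proof -
      obtain r1 t1 where 1: "0 < r1" "r1 < 1" "0 < t1" "fuzzy_ball Z N x r1 t1 \<subseteq> a"
        using Int x by blast
      obtain r2 t2 where 2: "0 < r2" "r2 < 1" "0 < t2" "fuzzy_ball Z N x r2 t2 \<subseteq> b"
        using Int x by blast
      have xZ: "x \<in> Z" using Int x by blast
      have "fuzzy_ball Z N x (min r1 r2) (min t1 t2) \<subseteq> fuzzy_ball Z N x r1 t1"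
        "fuzzy_ball Z N x (min r1 r2) (min t1 t2) \<subseteq> fuzzy_ball Z N x r2 t2"
        by (rule ball_mono; use xZ 1 2 in simp)+
      then show ?thesis
        using 1 2 by (intro exI[of _ "min r1 r2"] exI[of _ "min t1 t2"]) auto
    qed
    then show ?case using Int by blast
  next
    case (UN K)
    then show ?case by (meson Sup_least Union_iff Union_upper subset_trans)
  next
    case (Basis s)
    then obtain x r t where s: "s = fuzzy_ball Z N x r t" "x \<in> Z" "0 < r" "r < 1" "0 < t"
      by blast
    have "s \<subseteq> Z" by (auto simp: s(1) fuzzy_ball_def)
    moreover have "\<exists>r t. 0 < r \<and> r < 1 \<and> 0 < t \<and> fuzzy_ball Z N y r t \<subseteq> s" if "y \<in> s" for y
      using ball_refine[of x r t y] that s by metis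
    ultimately show ?case by blast
  qed
next
  assume R: "U \<subseteq> Z \<and> (\<forall>x\<in>U. \<exists>r t. 0 < r \<and> r < 1 \<and> 0 < t \<and> fuzzy_ball Z N x r t \<subseteq> U)"
  let ?K = "{fuzzy_ball Z N x r t | x r t. x \<in> U \<and> 0 < r \<and> r < 1 \<and> 0 < t \<and> fuzzy_ball Z N x r t \<subseteq> U}"
  have "U = \<Union>?K"
  proof
    show "U \<subseteq> \<Union>?K"
    proof
      fix x assume x: "x \<in> U"
      then obtain r t where "0 < r" "r < 1" "0 < t" "fuzzy_ball Z N x r t \<subseteq> U" using R by blast
      moreover from this have "x \<in> fuzzy_ball Z N x r t" using center_in_ball R x by blast
      ultimately show "x \<in> \<Union>?K" using x by blast
    qed
  qed blast
  moreover have "openin (fuzzy_topology Z N) (\<Union>?K)"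
    unfolding fuzzy_topology_def
    by (intro openin_Union ballI topology_generated_by_Basis) (use R in blast)
  ultimately show "openin (fuzzy_topology Z N) U" by simp
qed

lemma topspace_fuzzy_topology: "topspace (fuzzy_topology Z N) = Z"
proof -
  have "openin (fuzzy_topology Z N) Z"
    unfolding openin_fuzzy_topology_base
    by (auto simp: fuzzy_ball_def intro!: exI[of _ "1/2::real"])
  then show ?thesis
    by (metis openin_fuzzy_topology_base openin_subset openin_topspace subset_antisym)
qed

end

end

theory Submission
  imports Defs
begin

text \<open>Since \<open>f\<close> maps balls into balls of the same radius, the enlargement of \<open>f -` A\<close> lies in
  the preimage of the enlargement of \<open>A\<close>; hence every radius admissible for \<open>\<mu>\<close>, \<open>\<nu>\<close> is admissible
  for their images. This compares the two infima once the set of admissible radii in \<open>X\<close> is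
  nonempty, which holds because \<open>M\<close> is bounded away from \<open>0\<close> at each time on a compact space.\<close>

definition prokhorov_radii ::
  "'a set \<Rightarrow> ('a \<Rightarrow> 'a \<Rightarrow> real \<Rightarrow> real) \<Rightarrow> 'a measure \<Rightarrow> 'a measure \<Rightarrow> real \<Rightarrow> real set" where
  "prokhorov_radii Z N \<mu> \<nu> t =
     {r. 0 < r \<and> r < 1 \<and> (\<forall>A \<in> sets (fuzzy_borel Z N).
            measure \<mu> A \<le> measure \<nu> (fuzzy_enlarge Z N A r t) + r \<and>
            measure \<nu> A \<le> measure \<mu> (fuzzy_enlarge Z N A r t) + r)}"

lemma fuzzy_prokhorov_eq_Inf_radii: "fuzzy_prokhorov Z N \<mu> \<nu> t = 1 - Inf (prokhorov_radii Z N \<mu> \<nu> t)"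
  by (simp add: fuzzy_prokhorov_def prokhorov_radii_def)

context fuzzy_metric_space
begin

lemma opens_subset_Pow: "{U. openin (fuzzy_topology Z N) U} \<subseteq> Pow Z"
  using openin_subset topspace_fuzzy_topology by fastforce

lemma space_fuzzy_borel: "space (fuzzy_borel Z N) = Z"
  by (simp add: fuzzy_borel_def space_measure_of_conv)

lemma open_in_sets_fuzzy_borel: "openin (fuzzy_topology Z N) U \<Longrightarrow> U \<in> sets (fuzzy_borel Z N)"
  using opens_subset_Pow by (auto simp: fuzzy_borel_def)

lemma openin_fuzzy_ball:
  "\<lbrakk>x \<in> Z; r < 1; 0 < t\<rbrakk> \<Longrightarrow> openin (fuzzy_topology Z N) (fuzzy_ball Z N x r t)"
  unfolding openin_fuzzy_topology_base using ball_refine[of x r t]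
  by (metis (no_types, lifting) fuzzy_ball_def mem_Collect_eq subsetI)

text \<open>A union of open balls is open. Hence enlargements are Borel, even when \<open>A\<close>
  is an arbitrary subset, and pushforwards can be evaluated on them by
  \<open>measure_push\<close>.\<close>

lemma openin_fuzzy_enlarge:
  "\<lbrakk>A \<subseteq> Z; r < 1; 0 < t\<rbrakk> \<Longrightarrow> openin (fuzzy_topology Z N) (fuzzy_enlarge Z N A r t)"
  unfolding fuzzy_enlarge_def using openin_fuzzy_ball by blast

text \<open>Two triangle inequalities, along u, x, y, v, compare N at (u, v) with N at (x, y),
  provided some time is left over for the two short legs. Continuity in time supplies it: N x y is
  still positive at some s < t.\<close>

lemma locally_bounded_below:
  assumes "x \<in> Z" "y \<in> Z" "0 < t"
  obtains U V c where "openin (fuzzy_topology Z N) U" "openin (fuzzy_topology Z N) V"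
    "x \<in> U" "y \<in> V" "0 < c" "\<And>u v. \<lbrakk>u \<in> U; v \<in> V\<rbrakk> \<Longrightarrow> c \<le> N u v t"
proof -
  have tpos: "0 < N x y t" using pos assms by blast
  have "isCont (N x y) t"
    using cont[OF assms(1,2)] assms(3) by (simp add: continuous_on_eq_continuous_at)
  then have "(N x y \<longlongrightarrow> N x y t) (at_left t)"
    by (auto simp: isCont_def intro: filterlim_at_split[THEN iffD1, THEN conjunct1])
  then have "\<forall>\<^sub>F s in at_left t. 0 < N x y s"
    using tpos by (rule order_tendstoD)
  moreover have "\<forall>\<^sub>F s in at_left t. s \<in> {0<..<t}"
    using assms(3) by (rule eventually_at_left_real)
  ultimately have "\<forall>\<^sub>F s in at_left t. 0 < N x y s \<and> s \<in> {0<..<t}"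
    by (rule eventually_conj)
  then obtain s where s: "0 < N x y s" "0 < s" "s < t"
    using eventually_happens[of _ "at_left t"] trivial_limit_at_left_real by fastforce
  \<comment> \<open>The spare time t - s is shared equally by the legs from u to x and from y to
    v.\<close>
  define e where "e = (t - s) / 2"
  \<comment> \<open>Each short leg costs less than c, so of \<open>N x y s\<close> = 4c more than 2c
    survives. Also c \<le> 1/4, so c is a legitimate ball radius.\<close>
  define c where "c = N x y s / 4"
  have e: "0 < e" "e + s + e = t" using s by (auto simp: e_def field_simps)
  have c: "0 < c" "c < 1" using s range[OF assms(1,2) s(2)] by (auto simp: c_def)
  show thesis
  proof
    show "openin (fuzzy_topology Z N) (fuzzy_ball Z N x c e)"
      "openin (fuzzy_topology Z N) (fuzzy_ball Z N y c e)"
      using openin_fuzzy_ball assms c e by blast+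
    show "x \<in> fuzzy_ball Z N x c e" "y \<in> fuzzy_ball Z N y c e"
      using center_in_ball assms c e by blast+
    show "0 < c" by fact
    fix u v assume uv: "u \<in> fuzzy_ball Z N x c e" "v \<in> fuzzy_ball Z N y c e"
    then have Z: "u \<in> Z" "v \<in> Z" and u: "N u x e > 1 - c" and v: "N y v e > 1 - c"
      using sym[of x u e] assms e by (auto simp: fuzzy_ball_def)
    have "N u x e + N x y s - 1 \<le> N u y (e + s)"
      using triangle[OF Z(1) assms(1,2) e(1) s(2)] by (simp add: luk_def)
    moreover have "N u y (e + s) + N y v e - 1 \<le> N u v t"
      using triangle[OF Z(1) assms(2) Z(2), of "e + s" e] e s by (simp add: luk_def)
    ultimately show "c \<le> N u v t" using u v c by (simp add: c_def)
  qed
qed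

text \<open>The boxes U \<times> V of \<open>locally_bounded_below\<close> cover the compact product
  Z \<times> Z. A positive lower bound on each member of a finite subcover gives one on the union,
  namely the minimum.\<close>

lemma compact_bounded_below:
  assumes "compact_space (fuzzy_topology Z N)" "0 < t"
  obtains c where "0 < c" "\<And>x y. \<lbrakk>x \<in> Z; y \<in> Z\<rbrakk> \<Longrightarrow> c \<le> N x y t"
proof -
  let ?T = "fuzzy_topology Z N"
  let ?bdd = "\<lambda>W. \<exists>c>0. \<forall>(x, y)\<in>W. c \<le> N x y t"
  let ?C = "{W. openin (prod_topology ?T ?T) W \<and> ?bdd W}"
  have "compact_space (prod_topology ?T ?T)"
    using assms(1) by (simp add: compact_space_prod_topology)
  moreover have "topspace (prod_topology ?T ?T) \<subseteq> \<Union>?C"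
  proof
    fix p assume "p \<in> topspace (prod_topology ?T ?T)"
    then obtain x y where p: "p = (x, y)" "x \<in> Z" "y \<in> Z"
      by (auto simp: topspace_fuzzy_topology)
    obtain U V c where "openin ?T U" "openin ?T V" "x \<in> U" "y \<in> V" "0 < c"
      "\<And>u v. \<lbrakk>u \<in> U; v \<in> V\<rbrakk> \<Longrightarrow> c \<le> N u v t"
      using locally_bounded_below[OF p(2,3) assms(2)] by blast
    then have "U \<times> V \<in> ?C" "p \<in> U \<times> V" by (auto simp: openin_prod_Times_iff p)
    then show "p \<in> \<Union>?C" by blast
  qed
  ultimately obtain F where F: "finite F" "F \<subseteq> ?C" "topspace (prod_topology ?T ?T) \<subseteq> \<Union>F"
    unfolding compact_space_alt by (smt (verit) mem_Collect_eq)
  have "?bdd (\<Union>F)"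
    using F(1,2)
  proof (induction F)
    case empty
    \<comment> \<open>Over the empty union any positive constant is a lower bound.\<close>
    show ?case by (auto intro: exI[of _ 1])
  next
    case (insert W F)
    then obtain c d where "0 < c" "\<forall>(x, y)\<in>W. c \<le> N x y t" "0 < d" "\<forall>(x, y)\<in>\<Union>F. d \<le> N x y t"
      by auto
    then show ?case by (intro exI[of _ "min c d"]) fastforce
  qed
  then obtain c where c: "0 < c" "\<forall>(x, y)\<in>\<Union>F. c \<le> N x y t" by blast
  moreover have "Z \<times> Z \<subseteq> \<Union>F" using F(3) by (simp add: topspace_fuzzy_topology)
  ultimately show thesis by (intro that[of c]) blast+
qed

lemma space_prob_measures: "\<mu> \<in> prob_measures Z N \<Longrightarrow> space \<mu> = Z"
  using sets_eq_imp_space_eq[of \<mu> "fuzzy_borel Z N"] by (simp add: prob_measures_def space_fuzzy_borel)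

text \<open>For r so close to 1 that 1 - r lies below the uniform bound on N at time t, every ball
  of radius r is all of Z. Enlargements of nonempty sets then have measure 1, and both inequalities
  are trivial.\<close>

lemma prokhorov_radii_nonempty:
  assumes "compact_space (fuzzy_topology Z N)" "0 < t"
    and "\<mu> \<in> prob_measures Z N" "\<nu> \<in> prob_measures Z N"
  shows "prokhorov_radii Z N \<mu> \<nu> t \<noteq> {}"
proof -
  obtain c where c: "0 < c" "\<And>x y. \<lbrakk>x \<in> Z; y \<in> Z\<rbrakk> \<Longrightarrow> c \<le> N x y t"
    using compact_bounded_below assms by blast
  \<comment> \<open>The minimum with 1 keeps r \<ge> 1/2, as c is not known to be at most 1; halving
    makes 1 - r < c strict.\<close>
  define r where "r = 1 - min c 1 / 2"
  have r: "0 < r" "r < 1" "1 - r < c" using c(1) by (auto simp: r_def)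
  have enlarge: "fuzzy_enlarge Z N A r t = Z" if "A \<subseteq> Z" "A \<noteq> {}" for A
    using that c(2) r(3) by (force simp: fuzzy_enlarge_def fuzzy_ball_def)
  have *: "measure \<kappa> A \<le> measure \<rho> (fuzzy_enlarge Z N A r t) + r"
    if "A \<in> sets (fuzzy_borel Z N)" "\<kappa> \<in> prob_measures Z N" "\<rho> \<in> prob_measures Z N" for \<kappa> \<rho> A
  \<comment> \<open>The empty set has empty enlargement and is outside the scope of
    \<open>enlarge\<close>; there the claim reads 0 \<le> r.\<close>
  proof (cases "A = {}")
    case False
    interpret \<kappa>: prob_space \<kappa> using that by (simp add: prob_measures_def)
    interpret \<rho>: prob_space \<rho> using that by (simp add: prob_measures_def)
    have "A \<subseteq> Z" using sets.sets_into_space[OF that(1)] by (simp add: space_fuzzy_borel)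
    then have "measure \<rho> (fuzzy_enlarge Z N A r t) = 1"
      using enlarge[OF _ False] \<rho>.prob_space space_prob_measures[OF that(3)] by simp
    then show ?thesis using \<kappa>.prob_le_1[of A] r by linarith
  qed (use r in \<open>simp add: fuzzy_enlarge_def\<close>)
  have "r \<in> prokhorov_radii Z N \<mu> \<nu> t"
    using r * assms by (simp add: prokhorov_radii_def)
  then show ?thesis by blast
qed

end

locale nonexpanding_map = X: fuzzy_metric_space X M + Y: fuzzy_metric_space Y M'
  for X :: "'a set" and M and Y :: "'b set" and M' +
  fixes f :: "'a \<Rightarrow> 'b"
  assumes nonexpanding: "nonexpanding X M Y M' f"
begin

lemma maps: "x \<in> X \<Longrightarrow> f x \<in> Y"
  using nonexpanding by (auto simp: nonexpanding_def)

lemma image_ball: "\<lbrakk>x \<in> X; 0 < t; y \<in> fuzzy_ball X M x r t\<rbrakk> \<Longrightarrow> f y \<in> fuzzy_ball Y M' (f x) r t"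
  using nonexpanding by (fastforce simp: nonexpanding_def fuzzy_ball_def)

text \<open>A ball at \<open>f x\<close> inside \<open>U\<close> pulls back to a set containing the
  ball at x with the same radius and time.\<close>

lemma openin_vimage:
  assumes "openin (fuzzy_topology Y M') U"
  shows "openin (fuzzy_topology X M) (f -` U \<inter> X)"
  unfolding X.openin_fuzzy_topology_base
proof (intro conjI ballI)
  fix x assume x: "x \<in> f -` U \<inter> X"
  then obtain r t where rt: "0 < r" "r < 1" "0 < t" "fuzzy_ball Y M' (f x) r t \<subseteq> U"
    using assms unfolding Y.openin_fuzzy_topology_base by blast
  then have "fuzzy_ball X M x r t \<subseteq> f -` U \<inter> X"
    using image_ball[of x t _ r] x by (auto simp: fuzzy_ball_def)
  with rt show "\<exists>r t. 0 < r \<and> r < 1 \<and> 0 < t \<and> fuzzy_ball X M x r t \<subseteq> f -` U \<inter> X"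
    by blast
qed simp

lemma borel_measurable_map: "f \<in> measurable (fuzzy_borel X M) (fuzzy_borel Y M')"
  unfolding fuzzy_borel_def[of Y]
  using Y.opens_subset_Pow maps openin_vimage X.open_in_sets_fuzzy_borel
  by (intro measurable_measure_of) (auto simp: X.space_fuzzy_borel)

lemma measurable_map: "\<mu> \<in> prob_measures X M \<Longrightarrow> f \<in> measurable \<mu> (fuzzy_borel Y M')"
  using borel_measurable_map by (simp add: prob_measures_def cong: measurable_cong_sets)

lemma push_in_prob_measures:
  assumes "\<mu> \<in> prob_measures X M"
  shows "push Y M' f \<mu> \<in> prob_measures Y M'"
  using assms prob_space.prob_space_distr[OF _ measurable_map[OF assms]]
  by (simp add: prob_measures_def push_def)

lemma measure_push:
  assumes "\<mu> \<in> prob_measures X M" "A \<in> sets (fuzzy_borel Y M')"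
  shows "measure (push Y M' f \<mu>) A = measure \<mu> (f -` A \<inter> X)"
  unfolding push_def
  using measure_distr[OF measurable_map[OF assms(1)] assms(2)] X.space_prob_measures[OF assms(1)]
  by simp

lemma prokhorov_radii_push:
  assumes "\<mu> \<in> prob_measures X M" "\<nu> \<in> prob_measures X M" "0 < t"
  shows "prokhorov_radii X M \<mu> \<nu> t \<subseteq> prokhorov_radii Y M' (push Y M' f \<mu>) (push Y M' f \<nu>) t"
proof
  fix r assume r: "r \<in> prokhorov_radii X M \<mu> \<nu> t"
  then have r01: "0 < r" "r < 1" by (auto simp: prokhorov_radii_def)
  have "measure (push Y M' f \<mu>) A \<le> measure (push Y M' f \<nu>) (fuzzy_enlarge Y M' A r t) + r \<and>
        measure (push Y M' f \<nu>) A \<le> measure (push Y M' f \<mu>) (fuzzy_enlarge Y M' A r t) + r"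
    if A: "A \<in> sets (fuzzy_borel Y M')" for A
  proof -
    let ?B = "f -` A \<inter> X"
    have "A \<subseteq> Y" using sets.sets_into_space[OF A] by (simp add: Y.space_fuzzy_borel)
    then have E: "openin (fuzzy_topology Y M') (fuzzy_enlarge Y M' A r t)"
      using Y.openin_fuzzy_enlarge r01 assms by blast
    \<comment> \<open>The admissibility of r in X can be tested on ?B only because ?B is
      Borel.\<close>
    have B: "?B \<in> sets (fuzzy_borel X M)"
      using measurable_sets[OF borel_measurable_map A] by (simp add: X.space_fuzzy_borel)
    \<comment> \<open>If y is in the ball at x \<in> ?B, then \<open>f y\<close> is in the ball at
      \<open>f x\<close>, whose centre belongs to A.\<close>
    have sub: "fuzzy_enlarge X M ?B r t \<subseteq> f -` fuzzy_enlarge Y M' A r t \<inter> X"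
      using image_ball assms(3) by (fastforce simp: fuzzy_enlarge_def fuzzy_ball_def)
    have enl: "measure \<kappa> (fuzzy_enlarge X M ?B r t)
        \<le> measure (push Y M' f \<kappa>) (fuzzy_enlarge Y M' A r t)"
      if \<kappa>: "\<kappa> \<in> prob_measures X M" for \<kappa>
    proof -
      interpret prob_space \<kappa> using \<kappa> by (simp add: prob_measures_def)
      \<comment> \<open>Monotonicity of the measure requires the larger set to be measurable; it is
        the preimage of an open set.\<close>
      have "f -` fuzzy_enlarge Y M' A r t \<inter> X \<in> sets \<kappa>"
        using X.open_in_sets_fuzzy_borel[OF openin_vimage[OF E]] \<kappa> by (simp add: prob_measures_def)
      then show ?thesis
        unfolding measure_push[OF \<kappa> Y.open_in_sets_fuzzy_borel[OF E]]
        using sub by (intro finite_measure_mono)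
    qed
    have "measure \<mu> ?B \<le> measure \<nu> (fuzzy_enlarge X M ?B r t) + r"
      "measure \<nu> ?B \<le> measure \<mu> (fuzzy_enlarge X M ?B r t) + r"
      using r B by (auto simp: prokhorov_radii_def)
    then show ?thesis
      using enl[OF assms(1)] enl[OF assms(2)] measure_push[OF assms(1) A] measure_push[OF assms(2) A]
      by simp
  qed
  then show "r \<in> prokhorov_radii Y M' (push Y M' f \<mu>) (push Y M' f \<nu>) t"
    using r01 by (simp add: prokhorov_radii_def)
qed

end

theorem proposition3p9:
  fixes X :: "'a set" and M :: "'a \<Rightarrow> 'a \<Rightarrow> real \<Rightarrow> real"
    and Y :: "'b set" and M' :: "'b \<Rightarrow> 'b \<Rightarrow> real \<Rightarrow> real"
    and f :: "'a \<Rightarrow> 'b"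
  assumes "fuzzy_metric_space X M" and "compact_space (fuzzy_topology X M)"
    and "fuzzy_metric_space Y M'" and "compact_space (fuzzy_topology Y M')"
    and "nonexpanding X M Y M' f"
  shows "nonexpanding (prob_measures X M) (fuzzy_prokhorov X M)
           (prob_measures Y M') (fuzzy_prokhorov Y M') (push Y M' f)"
proof -
  interpret nonexpanding_map X M Y M' f
    using assms by (simp add: nonexpanding_map_def nonexpanding_map_axioms_def)
  have "fuzzy_prokhorov X M \<mu> \<nu> t \<le> fuzzy_prokhorov Y M' (push Y M' f \<mu>) (push Y M' f \<nu>) t"
    if "\<mu> \<in> prob_measures X M" "\<nu> \<in> prob_measures X M" "0 < t" for \<mu> \<nu> t
  proof -
    have "bdd_below (prokhorov_radii Y M' (push Y M' f \<mu>) (push Y M' f \<nu>) t)"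
      by (rule bdd_belowI[of _ 0]) (simp add: prokhorov_radii_def)
    then have "Inf (prokhorov_radii Y M' (push Y M' f \<mu>) (push Y M' f \<nu>) t)
        \<le> Inf (prokhorov_radii X M \<mu> \<nu> t)"
      \<comment> \<open>The larger set of radii has the smaller infimum;
        \<open>cInf_superset_mono\<close> asks for the smaller set to be nonempty and the larger one
        bounded below. Passing to 1 - Inf reverses the inequality.\<close>
      using X.prokhorov_radii_nonempty[OF assms(2) that(3,1,2)] prokhorov_radii_push[OF that]
      by (intro cInf_superset_mono)
    then show ?thesis by (simp add: fuzzy_prokhorov_eq_Inf_radii)
  qed
  then show ?thesis
    using push_in_prob_measures by (auto simp: nonexpanding_def)
qed

end
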